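(* Let $p$ be a prime, $m\in\{0,1,2,\dots\}\cup\{\infty\}$, and $s\in\mathbb{C}$ with $0<|s|<1$. Then $$\frac{\Delta^{(m)}_s}{2}\ \ge\ \sin\Big(\frac{\pi}{p}\Big)-\frac{|s|}{1-|s|}.$$ Consequently $\Delta^{(m)}_s>0$ whenever $|s|<s_0$, where $s_0=\dfrac{\sin(\pi/p)}{1+\sin(\pi/p)}$.
   Context: Each nonzero $x\in\mathbb{Q}_p$ is written uniquely as $x=\sum_{n\ge v(x)}x_np^n$ with $x_n\in\{0,\dots,p-1\}$ and $x_{v(x)}\neq0$; set $x_n=0$ for $n<v(x)$, $|x|_p=p^{-v(x)}$; for $x=0$ all digits are $0$, $v(0)=\infty$ and $|0|_p=0$. For $n\in\mathbb{Z}$ and $m\in\{0,1,2,\dots\}\cup\{\infty\}$ put $$\chi_n^{(m)}(x)=\exp\Big(\frac{2\pi i}{p}\sum_{k=0}^m x_{n-k}p^{-k}\Big).$$ For $0<|s|<1$ define $$\Upsilon^{(m)}_s(x)=\frac{1-s^{v(x)}}{1-s}+\sum_{n=v(x)}^\infty s^n\chi_n^{(m)}(x),$$ with $\Upsilon^{(m)}_s(0)=\frac1{1-s}$. Put $$\Delta^{(m)}_s=\inf\{|\Upsilon^{(m)}_s(x)-\Upsilon^{(m)}_s(y)|: x,y\in\mathbb{Q}_p,\ |x-y|_p=1\}.$$ *)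

theory Defs
  imports
    "HOL-Algebra.QuotRing"
    "HOL-Library.Extended_Nat"
    "HOL-Computational_Algebra.Primes"
    Complex_Main
begin

section \<open>The \<open>p\<close>-adic absolute value on the rationals\<close>

definition rat_val :: "nat \<Rightarrow> rat \<Rightarrow> int" where
  "rat_val p q =
     int (multiplicity (int p) (fst (quotient_of q))) -
     int (multiplicity (int p) (snd (quotient_of q)))"

definition rat_pabs :: "nat \<Rightarrow> rat \<Rightarrow> real" where
  "rat_pabs p q = (if q = 0 then 0 else real p powi (- rat_val p q))"


section \<open>The field of \<open>p\<close>-adic numbers\<close>

text \<open>
  The completion of the rationals at \<open>p\<close>, constructed as the ring of rational sequences that are
  Cauchy for the \<open>p\<close>-adic absolute value, modulo the ideal of null sequences. Its elements are
  thus sets of rational sequences, and \<open>X \<in> x\<close> says that \<open>X\<close> converges to \<open>x\<close>.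
\<close>

definition pCauchy :: "nat \<Rightarrow> (nat \<Rightarrow> rat) \<Rightarrow> bool" where
  "pCauchy p X \<longleftrightarrow> (\<forall>e>0. \<exists>M. \<forall>m\<ge>M. \<forall>n\<ge>M. rat_pabs p (X m - X n) < e)"

definition pCauchy_ring :: "nat \<Rightarrow> (nat \<Rightarrow> rat) ring" where
  "pCauchy_ring p =
     \<lparr>carrier = {X. pCauchy p X},
      monoid.mult = (\<lambda>X Y n. X n * Y n), one = (\<lambda>n. 1),
      zero = (\<lambda>n. 0), add = (\<lambda>X Y n. X n + Y n)\<rparr>"

definition pnull :: "nat \<Rightarrow> (nat \<Rightarrow> rat) set" where
  "pnull p = {X. (\<lambda>n. rat_pabs p (X n)) \<longlonglongrightarrow> 0}"

definition Qp :: "nat \<Rightarrow> (nat \<Rightarrow> rat) set ring" where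
  "Qp p = pCauchy_ring p Quot pnull p"


section \<open>Digit expansions, valuation and absolute value\<close>

text \<open>
  \<open>d\<close> is the digit sequence of \<open>x\<close>: almost all digits of negative index vanish, and
  \<open>x = (\<Sum>n. d n * p ^ n)\<close>, i.e. the partial sums of this series converge to \<open>x\<close>.
\<close>

definition is_expansion :: "nat \<Rightarrow> (nat \<Rightarrow> rat) set \<Rightarrow> (int \<Rightarrow> nat) \<Rightarrow> bool" where
  "is_expansion p x d \<longleftrightarrow>
     (\<forall>n. d n < p) \<and> (\<exists>N. \<forall>n<N. d n = 0) \<and>
     (\<lambda>N. \<Sum>n\<in>{- int N..<int N}. of_nat (d n) * of_nat p powi n) \<in> x"

definition digit :: "nat \<Rightarrow> (nat \<Rightarrow> rat) set \<Rightarrow> int \<Rightarrow> nat" where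
  "digit p x = (THE d. is_expansion p x d)"

text \<open>The valuation is only used for nonzero \<open>x\<close>; the convention \<open>v(0) = \<infinity>\<close> is
  reflected in the explicit values at \<open>0\<close> in the definitions below.\<close>

definition val :: "nat \<Rightarrow> (nat \<Rightarrow> rat) set \<Rightarrow> int" where
  "val p x = (THE n. digit p x n \<noteq> 0 \<and> (\<forall>k<n. digit p x k = 0))"

definition pabs :: "nat \<Rightarrow> (nat \<Rightarrow> rat) set \<Rightarrow> real" where
  "pabs p x = (if x = \<zero>\<^bsub>Qp p\<^esub> then 0 else real p powi (- val p x))"


section \<open>The maps \<open>\<Upsilon>\<close> and their separation constants\<close>

definition chi :: "nat \<Rightarrow> enat \<Rightarrow> int \<Rightarrow> (nat \<Rightarrow> rat) set \<Rightarrow> complex" where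
  "chi p m n x =
     exp (2 * complex_of_real pi * \<i> / of_nat p *
       of_real (case m of
           enat M \<Rightarrow> (\<Sum>k\<le>M. real (digit p x (n - int k)) / real p ^ k)
         | \<infinity> \<Rightarrow> (\<Sum>k. real (digit p x (n - int k)) / real p ^ k)))"

definition Upsilon :: "nat \<Rightarrow> enat \<Rightarrow> complex \<Rightarrow> (nat \<Rightarrow> rat) set \<Rightarrow> complex" where
  "Upsilon p m s x =
     (if x = \<zero>\<^bsub>Qp p\<^esub> then 1 / (1 - s)
      else (1 - s powi val p x) / (1 - s) +
           (\<Sum>j. s powi (val p x + int j) * chi p m (val p x + int j) x))"

definition Delta :: "nat \<Rightarrow> enat \<Rightarrow> complex \<Rightarrow> real" where
  "Delta p m s =
     Inf {cmod (Upsilon p m s x - Upsilon p m s y) | x y.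
            x \<in> carrier (Qp p) \<and> y \<in> carrier (Qp p) \<and> pabs p (x \<ominus>\<^bsub>Qp p\<^esub> y) = 1}"


section \<open>The \<open>p\<close>-adic numbers form a field\<close>

context
  fixes p :: nat
  assumes p: "prime p"
begin

lemma rat_val_div:
  assumes "a \<noteq> 0" "b \<noteq> 0"
  shows "rat_val p (of_int a / of_int b)
    = int (multiplicity (int p) a) - int (multiplicity (int p) b)"
proof -
  obtain c d where q: "quotient_of (of_int a / of_int b) = (c, d)" by force
  have d: "d > 0" using quotient_of_denom_pos[OF q] .
  have "(of_int a / of_int b :: rat) = of_int c / of_int d" using quotient_of_div[OF q] .
  then have "(of_int (a * d) :: rat) = of_int (c * b)"
    using assms d by (simp add: field_simps)
  then have e: "a * d = c * b" by (simp only: of_int_eq_iff)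
  then have c: "c \<noteq> 0" using assms d by auto
  have pe: "prime_elem (int p)" using p by auto
  have "multiplicity (int p) a + multiplicity (int p) d = multiplicity (int p) c + multiplicity (int p) b"
    using prime_elem_multiplicity_mult_distrib[OF pe, of a d]
      prime_elem_multiplicity_mult_distrib[OF pe, of c b] assms c d e by simp
  then show ?thesis by (simp add: rat_val_def q)
qed

lemma rat_frac:
  obtains a b :: int where "(x::rat) = of_int a / of_int b" "b > 0"
  using quotient_of_div quotient_of_denom_pos by (metis surj_pair)

lemma rat_val_mult:
  assumes "x \<noteq> 0" "y \<noteq> 0"
  shows "rat_val p (x * y) = rat_val p x + rat_val p y"
proof -
  obtain a b c d where x: "x = of_int a / of_int b" "b > 0" and y: "y = of_int c / of_int d" "d > 0"
    by (meson rat_frac)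
  have n: "a \<noteq> 0" "c \<noteq> 0" using assms x y by auto
  have pe: "prime_elem (int p)" using p by auto
  have "x * y = of_int (a * c) / of_int (b * d)" using x y by simp
  then have "rat_val p (x * y) = int (multiplicity (int p) (a*c)) - int (multiplicity (int p) (b*d))"
    using rat_val_div[of "a*c" "b*d"] n x y by simp
  then show ?thesis
    using rat_val_div[of a b] rat_val_div[of c d] n x y prime_elem_multiplicity_mult_distrib[OF pe]
    by simp
qed

lemma rat_val_add:
  assumes "x \<noteq> 0" "y \<noteq> 0" "x + y \<noteq> 0"
  shows "rat_val p (x + y) \<ge> min (rat_val p x) (rat_val p y)"
proof -
  obtain a b c d where x: "x = of_int a / of_int b" "b > 0" and y: "y = of_int c / of_int d" "d > 0"
    by (meson rat_frac)
  let ?m = "multiplicity (int p)"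
  have pu: "int p \<noteq> 0" "\<not> is_unit (int p)"
    using p by (auto simp: prime_gt_0_nat not_prime_unit)
  have xe: "x = of_int (a * d) / of_int (b * d)" and ye: "y = of_int (c * b) / of_int (b * d)"
    using x y by simp_all
  have s: "x + y = of_int (a * d + c * b) / of_int (b * d)"
    unfolding xe ye by (simp add: add_divide_distrib)
  have nz: "a * d \<noteq> 0" "c * b \<noteq> 0" "b * d \<noteq> 0" "a * d + c * b \<noteq> 0"
  proof -
    show "a * d \<noteq> 0" "c * b \<noteq> 0" "b * d \<noteq> 0" using assms x y by auto
    show "a * d + c * b \<noteq> 0" using assms(3) unfolding s by (metis div_0 of_int_0)
  qed
  let ?k = "min (?m (a*d)) (?m (c*b))"
  have "int p ^ ?k dvd a * d" "int p ^ ?k dvd c * b" by (auto intro: multiplicity_dvd')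
  then have "int p ^ ?k dvd a * d + c * b" by (rule dvd_add)
  then have "?k \<le> ?m (a * d + c * b)"
    using nz pu by (intro multiplicity_geI) auto
  then have "min (int (?m (a*d)) - int (?m (b*d))) (int (?m (c*b)) - int (?m (b*d)))
     \<le> int (?m (a * d + c * b)) - int (?m (b*d))" by linarith
  then show ?thesis
    using rat_val_div[OF nz(1,3)] rat_val_div[OF nz(2,3)] rat_val_div[OF nz(4,3)] xe ye s by metis
qed

lemma p_gt1: "real p > 1" using prime_gt_1_nat[OF p] by simp

lemma p_powi_le_iff: "real p powi a \<le> real p powi b \<longleftrightarrow> a \<le> b"
  using p_gt1 power_int_increasing[of a b "real p"] power_int_strict_increasing[of b a "real p"]
  by linarith

lemma rat_pabs_nonneg: "rat_pabs p x \<ge> 0"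
  by (simp add: rat_pabs_def)

lemma rat_pabs_zero [simp]: "rat_pabs p 0 = 0"
  by (simp add: rat_pabs_def)

lemma rat_pabs_0_iff [simp]: "rat_pabs p x = 0 \<longleftrightarrow> x = 0"
  using p_gt1 by (auto simp: rat_pabs_def)

lemma rat_pabs_mult: "rat_pabs p (x * y) = rat_pabs p x * rat_pabs p y"
  using p_gt1 by (auto simp: rat_pabs_def rat_val_mult power_int_diff power_int_minus field_simps
      simp flip: power_int_add)

lemma rat_pabs_1 [simp]: "rat_pabs p 1 = 1"
  by (simp add: rat_pabs_def rat_val_def)

lemma rat_pabs_minus [simp]: "rat_pabs p (- x) = rat_pabs p x"
proof -
  have "rat_pabs p (-1) = 1" by (simp add: rat_pabs_def rat_val_def multiplicity_unit_right)
  then show ?thesis using rat_pabs_mult[of "-1" x] by simp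
qed

lemma rat_pabs_minus_commute: "rat_pabs p (x - y) = rat_pabs p (y - x)"
  using rat_pabs_minus[of "x - y"] by simp

lemma rat_pabs_add_le: "rat_pabs p (x + y) \<le> max (rat_pabs p x) (rat_pabs p y)"
proof (cases "x = 0 \<or> y = 0 \<or> x + y = 0")
  case True
  then show ?thesis
    using rat_pabs_nonneg by (auto simp: le_max_iff_disj)
next
  case False
  then have "rat_val p x \<le> rat_val p (x + y) \<or> rat_val p y \<le> rat_val p (x + y)"
    using rat_val_add[of x y] by linarith
  then show ?thesis using False p_gt1
    by (auto simp: rat_pabs_def le_max_iff_disj power_int_increasing)
qed

lemma rat_pabs_diff_le: "rat_pabs p (x - y) \<le> max (rat_pabs p x) (rat_pabs p y)"
  using rat_pabs_add_le[of x "-y"] by simp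

lemma rat_pabs_add_lt: "rat_pabs p x < e \<Longrightarrow> rat_pabs p y < e \<Longrightarrow> rat_pabs p (x + y) < e"
  using rat_pabs_add_le[of x y] by linarith

lemma pnull_iff: "X \<in> pnull p \<longleftrightarrow> (\<forall>e>0. \<exists>M. \<forall>n\<ge>M. rat_pabs p (X n) < e)"
  by (simp add: pnull_def lim_sequentially dist_real_def rat_pabs_nonneg)

lemma pnull_uminus: "X \<in> pnull p \<Longrightarrow> (\<lambda>n. - X n) \<in> pnull p"
  by (simp add: pnull_def)

lemma pnull_add:
  assumes "X \<in> pnull p" "Y \<in> pnull p" shows "(\<lambda>n. X n + Y n) \<in> pnull p"
  unfolding pnull_iff
proof (intro allI impI)
  fix e :: real assume "e > 0"
  then obtain M M' where "\<forall>n\<ge>M. rat_pabs p (X n) < e" "\<forall>n\<ge>M'. rat_pabs p (Y n) < e"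
    using assms[unfolded pnull_iff, rule_format, of e] by blast
  then show "\<exists>M. \<forall>n\<ge>M. rat_pabs p (X n + Y n) < e"
    by (intro exI[of _ "max M M'"]) (auto intro: rat_pabs_add_lt)
qed

lemma pnull_imp_pCauchy: assumes "X \<in> pnull p" shows "pCauchy p X"
  unfolding pCauchy_def
proof (intro allI impI)
  fix e :: real assume "e > 0"
  then obtain M where "\<And>n. n \<ge> M \<Longrightarrow> rat_pabs p (X n) < e" using assms pnull_iff by blast
  then show "\<exists>M. \<forall>m\<ge>M. \<forall>n\<ge>M. rat_pabs p (X m - X n) < e"
    by (meson rat_pabs_diff_le le_less_trans max_less_iff_conj)
qed

lemma pCauchy_const: "pCauchy p (\<lambda>_. c)"
  by (auto simp: pCauchy_def rat_pabs_def)

lemma pCauchy_uminus: "pCauchy p X \<Longrightarrow> pCauchy p (\<lambda>n. - X n)"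
  unfolding pCauchy_def using rat_pabs_minus_commute by simp

lemma pCauchy_add: assumes "pCauchy p X" "pCauchy p Y" shows "pCauchy p (\<lambda>n. X n + Y n)"
  unfolding pCauchy_def
proof (intro allI impI)
  fix e :: real assume "e > 0"
  then obtain M M' where M: "\<And>m n. m \<ge> M \<Longrightarrow> n \<ge> M \<Longrightarrow> rat_pabs p (X m - X n) < e"
     "\<And>m n. m \<ge> M' \<Longrightarrow> n \<ge> M' \<Longrightarrow> rat_pabs p (Y m - Y n) < e"
    using assms unfolding pCauchy_def by metis
  show "\<exists>M. \<forall>m\<ge>M. \<forall>n\<ge>M. rat_pabs p (X m + Y m - (X n + Y n)) < e"
    using rat_pabs_add_lt[OF M(1) M(2)]
    by (intro exI[of _ "max M M'"]) (auto simp: algebra_simps)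
qed

lemma pCauchy_bounded: assumes "pCauchy p X" obtains B where "B > 0" "\<And>n. rat_pabs p (X n) \<le> B"
proof -
  obtain M where M: "\<And>m n. m \<ge> M \<Longrightarrow> n \<ge> M \<Longrightarrow> rat_pabs p (X m - X n) < 1"
    using assms unfolding pCauchy_def by (metis zero_less_one)
  define B where "B = Max (insert 1 ((\<lambda>n. rat_pabs p (X n)) ` {..M}))"
  have f: "finite (insert 1 ((\<lambda>n. rat_pabs p (X n)) ` {..M}))" by simp
  have B1: "1 \<le> B" and Bn: "n \<le> M \<Longrightarrow> rat_pabs p (X n) \<le> B" for n
    unfolding B_def using Max_ge[OF f] by auto
  have "rat_pabs p (X n) \<le> B" for n
  proof (cases "n \<le> M")
    case False
    then have "rat_pabs p (X n - X M) \<le> B" using M[of n M] B1 by simp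
    moreover have "rat_pabs p (X M) \<le> B" using Bn by simp
    ultimately show ?thesis using rat_pabs_add_le[of "X n - X M" "X M"] by simp
  qed (rule Bn)
  then show ?thesis using that[of B] B1 by simp
qed

lemma pnull_mult: assumes "X \<in> pnull p" "pCauchy p Y" shows "(\<lambda>n. X n * Y n) \<in> pnull p"
  unfolding pnull_iff
proof (intro allI impI)
  fix e :: real assume e: "e > 0"
  obtain B where B: "B > 0" "\<And>n. rat_pabs p (Y n) \<le> B" using pCauchy_bounded[OF assms(2)] by blast
  obtain M where "\<And>n. n \<ge> M \<Longrightarrow> rat_pabs p (X n) < e / B"
    using assms(1) e B unfolding pnull_iff by (meson divide_pos_pos)
  then have "rat_pabs p (X n * Y n) < e" if "n \<ge> M" for n
    using that B rat_pabs_mult rat_pabs_nonneg mult_less_le_imp_less[of _ "e/B" _ B]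
    by (smt (verit, best) mult_left_mono nonzero_eq_divide_eq pos_less_divide_eq)
  then show "\<exists>M. \<forall>n\<ge>M. rat_pabs p (X n * Y n) < e" by blast
qed

lemma pCauchy_mult: assumes "pCauchy p X" "pCauchy p Y" shows "pCauchy p (\<lambda>n. X n * Y n)"
  unfolding pCauchy_def
proof (intro allI impI)
  fix e :: real assume e: "e > 0"
  obtain B where B: "B > 0" "\<And>n. rat_pabs p (X n) \<le> B" using pCauchy_bounded[OF assms(1)] by blast
  obtain C where C: "C > 0" "\<And>n. rat_pabs p (Y n) \<le> C" using pCauchy_bounded[OF assms(2)] by blast
  obtain M M' where M: "\<And>m n. m \<ge> M \<Longrightarrow> n \<ge> M \<Longrightarrow> rat_pabs p (X m - X n) < e / C"
     "\<And>m n. m \<ge> M' \<Longrightarrow> n \<ge> M' \<Longrightarrow> rat_pabs p (Y m - Y n) < e / B"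
    using assms e B C unfolding pCauchy_def by (metis divide_pos_pos)
  have "rat_pabs p (X m * Y m - X n * Y n) < e" if "m \<ge> max M M'" "n \<ge> max M M'" for m n
  proof -
    have "rat_pabs p (X m - X n) * rat_pabs p (Y m) < e"
      using M(1)[of m n] that B C(1) C(2)[of m] rat_pabs_nonneg[of "X m - X n"] rat_pabs_nonneg[of "Y m"]
      by (smt (verit, best) max.boundedE mult_left_mono pos_less_divide_eq)
    moreover have "rat_pabs p (X n) * rat_pabs p (Y m - Y n) < e"
      using M(2)[of m n] that B(1) B(2)[of n] rat_pabs_nonneg[of "Y m - Y n"] rat_pabs_nonneg[of "X n"]
      by (smt (verit, best) max.boundedE mult_right_mono pos_less_divide_eq mult.commute)
    ultimately have "rat_pabs p ((X m - X n) * Y m + X n * (Y m - Y n)) < e"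
      by (intro rat_pabs_add_lt) (simp_all add: rat_pabs_mult)
    then show ?thesis by (simp add: algebra_simps)
  qed
  then show "\<exists>M. \<forall>m\<ge>M. \<forall>n\<ge>M. rat_pabs p (X m * Y m - X n * Y n) < e" by blast
qed

lemma cring_pCauchy_ring: "cring (pCauchy_ring p)"
proof (rule cringI)
  show "abelian_group (pCauchy_ring p)"
  proof (rule abelian_groupI)
    fix X assume "X \<in> carrier (pCauchy_ring p)"
    then show "\<exists>Y\<in>carrier (pCauchy_ring p). Y \<oplus>\<^bsub>pCauchy_ring p\<^esub> X = \<zero>\<^bsub>pCauchy_ring p\<^esub>"
      by (intro bexI[of _ "\<lambda>n. - X n"]) (auto simp: pCauchy_ring_def pCauchy_uminus)
  qed (auto simp: pCauchy_ring_def pCauchy_add pCauchy_const algebra_simps)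
  show "comm_monoid (pCauchy_ring p)"
    by (rule comm_monoidI) (auto simp: pCauchy_ring_def pCauchy_mult pCauchy_const algebra_simps)
qed (auto simp: pCauchy_ring_def algebra_simps)

lemma pCauchy_ring_uminus:
  assumes "pCauchy p X" shows "\<ominus>\<^bsub>pCauchy_ring p\<^esub> X = (\<lambda>n. - X n)"
proof -
  interpret cring "pCauchy_ring p" by (rule cring_pCauchy_ring)
  show ?thesis
    by (rule minus_equality) (use assms in \<open>auto simp: pCauchy_ring_def pCauchy_uminus\<close>)
qed

lemma ideal_pnull: "ideal (pnull p) (pCauchy_ring p)"
proof -
  interpret cring "pCauchy_ring p" by (rule cring_pCauchy_ring)
  show ?thesis
  proof (rule idealI)
    show "ring (pCauchy_ring p)" by (rule ring_axioms)
    show "subgroup (pnull p) (add_monoid (pCauchy_ring p))"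
    proof (rule add.subgroupI)
      show "pnull p \<subseteq> carrier (pCauchy_ring p)"
        by (auto simp: pCauchy_ring_def pnull_imp_pCauchy)
      show "pnull p \<noteq> {}" by (auto simp: pnull_def rat_pabs_def intro!: exI[of _ "\<lambda>_. 0"])
      show "\<ominus>\<^bsub>pCauchy_ring p\<^esub> X \<in> pnull p" if "X \<in> pnull p" for X
        using that by (simp add: pCauchy_ring_uminus pnull_imp_pCauchy) (simp add: pnull_def)
      show "X \<oplus>\<^bsub>pCauchy_ring p\<^esub> Y \<in> pnull p" if "X \<in> pnull p" "Y \<in> pnull p" for X Y
        using pnull_add[OF that] by (simp add: pCauchy_ring_def)
    qed
  next
    fix X Y assume "X \<in> pnull p" "Y \<in> carrier (pCauchy_ring p)"
    then have *: "(\<lambda>n. X n * Y n) \<in> pnull p" by (simp add: pCauchy_ring_def pnull_mult)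
    then show "X \<otimes>\<^bsub>pCauchy_ring p\<^esub> Y \<in> pnull p" by (simp add: pCauchy_ring_def)
    from * show "Y \<otimes>\<^bsub>pCauchy_ring p\<^esub> X \<in> pnull p" by (simp add: pCauchy_ring_def mult.commute)
  qed
qed

lemma cring_Qp: "cring (Qp p)"
  unfolding Qp_def by (intro ideal.quotient_is_cring ideal_pnull cring_pCauchy_ring)

lemma mem_coset_iff:
  "Y \<in> pnull p +>\<^bsub>pCauchy_ring p\<^esub> X \<longleftrightarrow> (\<lambda>n. Y n - X n) \<in> pnull p"
proof -
  have "Y = (\<lambda>n. h n + X n) \<longleftrightarrow> h = (\<lambda>n. Y n - X n)" for h :: "nat \<Rightarrow> rat"
    by (auto simp: fun_eq_iff algebra_simps)
  then show ?thesis
    by (auto simp: a_r_coset_def r_coset_def pCauchy_ring_def)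
qed

lemma carrier_Qp: "carrier (Qp p) = {pnull p +>\<^bsub>pCauchy_ring p\<^esub> X | X. pCauchy p X}"
  by (auto simp: Qp_def FactRing_def A_RCOSETS_def RCOSETS_def pCauchy_ring_def a_r_coset_def)

lemma Qp_simps:
  assumes "pCauchy p X" "pCauchy p Y"
  shows "(pnull p +>\<^bsub>pCauchy_ring p\<^esub> X) \<otimes>\<^bsub>Qp p\<^esub> (pnull p +>\<^bsub>pCauchy_ring p\<^esub> Y)
      = pnull p +>\<^bsub>pCauchy_ring p\<^esub> (\<lambda>n. X n * Y n)"
    and "\<one>\<^bsub>Qp p\<^esub> = pnull p +>\<^bsub>pCauchy_ring p\<^esub> (\<lambda>n. 1)" and "\<zero>\<^bsub>Qp p\<^esub> = pnull p"
  using ideal.rcoset_mult_add[OF ideal_pnull, of X Y] assms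
  by (simp_all add: Qp_def FactRing_def) (simp_all add: pCauchy_ring_def)

lemma coset_eqI:
  assumes "(\<lambda>n. X n - Y n) \<in> pnull p"
  shows "pnull p +>\<^bsub>pCauchy_ring p\<^esub> X = pnull p +>\<^bsub>pCauchy_ring p\<^esub> Y"
proof (rule Set.set_eqI)
  fix Z
  show "Z \<in> pnull p +>\<^bsub>pCauchy_ring p\<^esub> X \<longleftrightarrow> Z \<in> pnull p +>\<^bsub>pCauchy_ring p\<^esub> Y"
    unfolding mem_coset_iff
    using pnull_add[OF _ assms, of "\<lambda>n. Z n - X n"]
      pnull_add[OF _ pnull_uminus[OF assms], of "\<lambda>n. Z n - Y n"] by auto
qed

lemma pCauchy_not_null:
  assumes "pCauchy p X" "X \<notin> pnull p"
  obtains e M where "e > 0" "\<And>n. n \<ge> M \<Longrightarrow> rat_pabs p (X n) \<ge> e"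
proof -
  obtain e where e: "e > 0" "\<And>M. \<exists>n\<ge>M. rat_pabs p (X n) \<ge> e"
    using assms(2) unfolding pnull_iff by (meson not_less)
  obtain M where M: "\<forall>m\<ge>M. \<forall>n\<ge>M. rat_pabs p (X m - X n) < e"
    using assms(1) e(1) unfolding pCauchy_def by blast
  obtain m where m: "m \<ge> M" "rat_pabs p (X m) \<ge> e" using e(2) by blast
  have "rat_pabs p (X n) \<ge> e" if "n \<ge> M" for n
    using rat_pabs_add_le[of "X m - X n" "X n"] M m that by fastforce
  then show ?thesis using that e(1) by blast
qed

lemma pCauchy_inverse:
  assumes "pCauchy p X" "X \<notin> pnull p"
  shows "pCauchy p (\<lambda>n. inverse (X n))"
  unfolding pCauchy_def
proof (intro allI impI)
  fix e :: real assume e: "e > 0"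
  obtain c L where c: "c > 0" "\<And>n. n \<ge> L \<Longrightarrow> rat_pabs p (X n) \<ge> c"
    using pCauchy_not_null[OF assms] by blast
  obtain M where M: "\<forall>m\<ge>M. \<forall>n\<ge>M. rat_pabs p (X m - X n) < e * (c * c)"
    using assms(1) e c(1) unfolding pCauchy_def by (meson mult_pos_pos)
  have "rat_pabs p (inverse (X m) - inverse (X n)) < e" if "m \<ge> max L M" "n \<ge> max L M" for m n
  proof -
    let ?t = "rat_pabs p (inverse (X m) - inverse (X n))"
    have nz: "X m \<noteq> 0" "X n \<noteq> 0" using c(2)[of m] c(2)[of n] c(1) that by auto
    have "X n - X m = (inverse (X m) - inverse (X n)) * (X m * X n)" using nz by (simp add: field_simps)
    then have "?t * (rat_pabs p (X m) * rat_pabs p (X n)) = rat_pabs p (X n - X m)"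
      by (simp add: rat_pabs_mult)
    moreover have "rat_pabs p (X m) * rat_pabs p (X n) \<ge> c * c"
      using c that by (intro mult_mono) (auto simp: rat_pabs_nonneg)
    then have "?t * (c * c) \<le> ?t * (rat_pabs p (X m) * rat_pabs p (X n))"
      by (intro mult_left_mono) (auto simp: rat_pabs_nonneg)
    moreover have "rat_pabs p (X n - X m) < e * (c * c)" using M that by simp
    ultimately have "?t * (c * c) < e * (c * c)" by linarith
    then show ?thesis using c(1) by simp
  qed
  then show "\<exists>M. \<forall>m\<ge>M. \<forall>n\<ge>M. rat_pabs p (inverse (X m) - inverse (X n)) < e" by blast
qed

lemma field_Qp: "field (Qp p)"
proof (rule cring.cring_fieldI2[OF cring_Qp])
  have "(\<lambda>n. 1) \<notin> pnull p" unfolding pnull_iff by (auto intro: exI[of _ 1])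
  then show "\<zero>\<^bsub>Qp p\<^esub> \<noteq> \<one>\<^bsub>Qp p\<^esub>"
    using mem_coset_iff[of "\<lambda>n. 1" "\<lambda>n. 1"]
    by (auto simp: Qp_simps(2,3)[OF pCauchy_const pCauchy_const] pnull_def)
next
  fix x assume x: "x \<in> carrier (Qp p)" "x \<noteq> \<zero>\<^bsub>Qp p\<^esub>"
  then obtain X where X: "pCauchy p X" "x = pnull p +>\<^bsub>pCauchy_ring p\<^esub> X"
    unfolding carrier_Qp by auto
  have "x = pnull p" if "X \<in> pnull p"
    using coset_eqI[of X "\<lambda>n. 0"] that mem_coset_iff[of _ "\<lambda>n. 0"] X by auto
  then have nn: "X \<notin> pnull p"
    using x Qp_simps(3)[OF pCauchy_const pCauchy_const] by auto
  obtain c L where c: "c > 0" "\<And>n. n \<ge> L \<Longrightarrow> rat_pabs p (X n) \<ge> c"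
    using pCauchy_not_null[OF X(1) nn] by blast
  have "X n * inverse (X n) - 1 = 0" if "n \<ge> L" for n
    using c(1) c(2)[OF that] by (cases "X n = 0") auto
  then have "(\<lambda>n. X n * inverse (X n) - 1) \<in> pnull p"
    unfolding pnull_iff by (metis rat_pabs_zero)
  then have "x \<otimes>\<^bsub>Qp p\<^esub> (pnull p +>\<^bsub>pCauchy_ring p\<^esub> (\<lambda>n. inverse (X n))) = \<one>\<^bsub>Qp p\<^esub>"
    unfolding X(2) Qp_simps(1)[OF X(1) pCauchy_inverse[OF X(1) nn]] Qp_simps(2)[OF X(1) X(1)]
    by (rule coset_eqI)
  then show "\<exists>y\<in>carrier (Qp p). x \<otimes>\<^bsub>Qp p\<^esub> y = \<one>\<^bsub>Qp p\<^esub>"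
    using pCauchy_inverse[OF X(1) nn] unfolding carrier_Qp by blast
qed


section \<open>Existence and uniqueness of digit expansions\<close>

lemma rat_pabs_int_le_iff: "rat_pabs p (of_int a) \<le> real p powi (- int j) \<longleftrightarrow> int p ^ j dvd a"
proof (cases "a = 0")
  case False
  have pu: "int p \<noteq> 0" "\<not> is_unit (int p)"
    using p by (auto simp: prime_gt_0_nat not_prime_unit)
  have "rat_val p (of_int a) = int (multiplicity (int p) a)"
    using rat_val_div[OF False, of 1] by simp
  then have "rat_pabs p (of_int a) \<le> real p powi (- int j) \<longleftrightarrow> j \<le> multiplicity (int p) a"
    using False by (simp add: rat_pabs_def p_powi_le_iff)
  also have "\<dots> \<longleftrightarrow> int p ^ j dvd a"
    using pu False by (subst power_dvd_iff_le_multiplicity) auto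
  finally show ?thesis .
qed (simp)

lemma rat_pabs_power: "rat_pabs p (of_nat p powi n) = real p powi (- n)"
proof -
  have "rat_pabs p (of_nat p) = inverse (real p)"
    using rat_val_div[of "int p" 1] p p_gt1
    by (simp add: rat_pabs_def multiplicity_prime power_int_minus)
  then have *: "rat_pabs p (of_nat p ^ k) = inverse (real p) ^ k" for k
    by (induction k) (auto simp: rat_pabs_mult)
  have inv: "rat_pabs p (inverse q) = inverse (rat_pabs p q)" for q
  proof (cases "q = 0")
    case False
    then have "rat_pabs p q * rat_pabs p (inverse q) = 1" by (simp flip: rat_pabs_mult)
    then show ?thesis by (metis inverse_unique)
  qed simp
  show ?thesis
    by (cases "n \<ge> 0") (simp_all add: power_int_def * inv power_inverse)
qed

lemma rat_pabs_sum_le: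
  assumes "\<And>i. i \<in> A \<Longrightarrow> rat_pabs p (f i) \<le> B" "B \<ge> 0"
  shows "rat_pabs p (sum f A) \<le> B"
  using assms(1)
proof (induction A rule: infinite_finite_induct)
  case (insert i A)
  then show ?case using rat_pabs_add_le[of "f i" "sum f A"] by fastforce
qed (use assms(2) in auto)

lemma rat_approx:
  assumes "rat_pabs p q \<le> 1"
  obtains r where "0 \<le> r" "r < int p ^ j" "rat_pabs p (q - of_int r) \<le> real p powi (- int j)"
proof -
  obtain a b where q: "quotient_of q = (a, b)" by force
  have b: "b > 0" and cop: "coprime a b" and qe: "q = of_int a / of_int b"
    using quotient_of_denom_pos[OF q] quotient_of_coprime[OF q] quotient_of_div[OF q] by auto
  have pu: "int p \<noteq> 0" "\<not> is_unit (int p)"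
    using p by (auto simp: prime_gt_0_nat not_prime_unit)
  have nd: "\<not> int p dvd b"
  proof
    assume pb: "int p dvd b"
    then have na: "\<not> int p dvd a" using cop pu coprime_common_divisor by blast
    then have a0: "a \<noteq> 0" by auto
    then have "rat_val p q = - int (multiplicity (int p) b)"
      using rat_val_div[OF a0, of b] b qe na by (simp add: not_dvd_imp_multiplicity_0)
    moreover have "multiplicity (int p) b > 0"
      using pb b pu by (subst multiplicity_gt_zero_iff) auto
    ultimately have "rat_pabs p q > 1"
      using a0 b qe p_gt1 by (simp add: rat_pabs_def)
    then show False using assms by simp
  qed
  have bv: "rat_pabs p (of_int b) = 1"
    using rat_val_div[of b 1] b nd by (simp add: rat_pabs_def not_dvd_imp_multiplicity_0)
  have "coprime (int p) b" using nd p by (intro prime_imp_coprime) auto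
  then have "coprime b (int p ^ j)" by (simp add: coprime_commute)
  then obtain u v where uv: "u * b + v * int p ^ j = 1" using bezout_int[of b "int p ^ j"] by auto
  define r where "r = (a * u) mod (int p ^ j)"
  have P: "int p ^ j > 0" using p by (simp add: prime_gt_0_nat)
  obtain w where w: "a * u = r + int p ^ j * w"
    unfolding r_def by (metis mod_mult_div_eq)
  have "a - b * r = a * (u * b + v * int p ^ j) - b * (a * u - int p ^ j * w)"
    using uv w by simp
  also have "\<dots> = int p ^ j * (a * v + b * w)" by (simp add: algebra_simps)
  finally have "int p ^ j dvd a - b * r" by simp
  then have "rat_pabs p (of_int (a - b * r)) \<le> real p powi (- int j)"
    unfolding rat_pabs_int_le_iff .
  moreover have "of_int (a - b * r) = (q - of_int r) * of_int b"
    using b by (simp add: qe field_simps)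
  ultimately have "rat_pabs p (q - of_int r) \<le> real p powi (- int j)"
    by (simp add: rat_pabs_mult bv)
  then show ?thesis using that[of r] P by (simp add: r_def)
qed

lemma pCauchy_approx:
  assumes "pCauchy p Z" "\<And>n. rat_pabs p (Z n) \<le> 1"
  shows "\<exists>r. 0 \<le> r \<and> r < int p ^ j \<and> (\<exists>M. \<forall>n\<ge>M. rat_pabs p (Z n - of_int r) \<le> real p powi (- int j))"
proof -
  have "real p powi (- int j) > 0" using p_gt1 by simp
  then obtain M where M: "\<forall>m\<ge>M. \<forall>n\<ge>M. rat_pabs p (Z m - Z n) < real p powi (- int j)"
    using assms(1) unfolding pCauchy_def by blast
  obtain r where r: "0 \<le> r" "r < int p ^ j" "rat_pabs p (Z M - of_int r) \<le> real p powi (- int j)"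
    using rat_approx[OF assms(2)] by blast
  have "rat_pabs p (Z n - of_int r) \<le> real p powi (- int j)" if "n \<ge> M" for n
    using rat_pabs_add_le[of "Z n - Z M" "Z M - of_int r"] M r(3) that by fastforce
  then show ?thesis using r by blast
qed

lemma expansion_exists:
  assumes "x \<in> carrier (Qp p)" shows "\<exists>d. is_expansion p x d"
proof -
  obtain X where X: "pCauchy p X" "x = pnull p +>\<^bsub>pCauchy_ring p\<^esub> X"
    using assms unfolding carrier_Qp by auto
  obtain B where B: "B > 0" "\<And>n. rat_pabs p (X n) \<le> B" using pCauchy_bounded[OF X(1)] by blast
  obtain K where K: "B < real p ^ K" using real_arch_pow[OF p_gt1] by blast
  define Z where "Z = (\<lambda>n. of_nat p ^ K * X n)"
  have pK: "rat_pabs p (of_nat p ^ K) = inverse (real p ^ K)"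
    using rat_pabs_power[of "int K"] by (simp add: power_int_minus)
  have Z1: "rat_pabs p (Z n) \<le> 1" for n
    using B(2)[of n] K p_gt1 by (simp add: Z_def rat_pabs_mult pK field_simps)
  have ZC: "pCauchy p Z" unfolding Z_def by (intro pCauchy_mult pCauchy_const X)
  obtain r where r: "\<And>j. 0 \<le> r j" "\<And>j. r j < int p ^ j"
     "\<And>j. \<exists>M. \<forall>n\<ge>M. rat_pabs p (Z n - of_int (r j)) \<le> real p powi (- int j)"
    using pCauchy_approx[OF ZC Z1] by metis
  have rr: "int p ^ j dvd r k - r j" if "j \<le> k" for j k
  proof -
    obtain M M' where "\<forall>n\<ge>M. rat_pabs p (Z n - of_int (r j)) \<le> real p powi (- int j)"
      "\<forall>n\<ge>M'. rat_pabs p (Z n - of_int (r k)) \<le> real p powi (- int k)"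
      using r(3) by blast
    then have "rat_pabs p (Z (max M M') - of_int (r j)) \<le> real p powi (- int j)"
      "rat_pabs p (Z (max M M') - of_int (r k)) \<le> real p powi (- int k)" by auto
    moreover have "real p powi (- int k) \<le> real p powi (- int j)" using that by (simp add: p_powi_le_iff)
    ultimately have "rat_pabs p (of_int (r k - r j)) \<le> real p powi (- int j)"
      using rat_pabs_diff_le[of "Z (max M M') - of_int (r j)" "Z (max M M') - of_int (r k)"] by simp
    then show ?thesis unfolding rat_pabs_int_le_iff .
  qed
  have P: "int p ^ j > 0" for j using p by (simp add: prime_gt_0_nat)
  define d where "d = (\<lambda>j. nat (r (Suc j) div int p ^ j))"
  have d1: "r (Suc j) = r j + int (d j) * int p ^ j" and d2: "d j < p" for j
  proof -
    obtain c where c: "r (Suc j) = r j + int p ^ j * c" using rr[of j "Suc j"] by (auto simp: dvd_def algebra_simps)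
    have cc: "r (Suc j) div int p ^ j = c" unfolding c using r(1,2)[of j] P[of j] by simp
    have "c \<ge> 0" using cc r(1)[of "Suc j"] P[of j] pos_imp_zdiv_nonneg_iff by blast
    moreover have "int p ^ j * c < int p ^ j * int p" using r(2)[of "Suc j"] r(1)[of j] c by (simp add: mult.commute)
    then have "c < int p" using P[of j] by simp
    ultimately show "r (Suc j) = r j + int (d j) * int p ^ j" "d j < p" using c cc by (auto simp: d_def)
  qed
  have r0: "r 0 = 0" using r(1)[of 0] r(2)[of 0] by simp
  have rs: "of_int (r j) = (\<Sum>i<j. of_nat (d i) * of_nat p ^ i :: rat)" for j
    by (induction j) (auto simp: r0 d1)
  define D where "D = (\<lambda>n. if n < - int K then 0 else d (nat (n + int K)))"
  define S where "S = (\<lambda>N. \<Sum>n\<in>{- int N..<int N}. of_nat (D n) * of_nat p powi n :: rat)"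
  have p0: "(of_nat p :: rat) \<noteq> 0" using p by auto
  have S: "of_nat p ^ K * S N = of_int (r (N + K))" if "N \<ge> K" for N
  proof -
    have "S N = (\<Sum>n\<in>{- int K..<int N}. of_nat (D n) * of_nat p powi n)"
      unfolding S_def by (rule sum.mono_neutral_right) (use that in \<open>auto simp: D_def\<close>)
    also have "\<dots> = (\<Sum>i<N+K. of_nat (d i) * of_nat p powi (int i - int K))"
      by (rule sum.reindex_bij_witness[of _ "\<lambda>i. int i - int K" "\<lambda>n. nat (n + int K)"])
         (use that in \<open>auto simp: D_def\<close>)
    finally show ?thesis using p0 by (simp add: rs sum_distrib_left power_int_diff mult.commute)
  qed
  have "(\<lambda>N. S N - X N) \<in> pnull p" unfolding pnull_iff
  proof (intro allI impI)
    fix e :: real assume e: "e > 0"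
    have "\<exists>j. inverse (real p) ^ j < e / real p ^ K"
      using e p_gt1 by (intro real_arch_pow_inv) (auto simp: field_simps)
    then obtain j where j: "real p ^ K * real p powi (- int j) < e"
      using p_gt1 by (auto simp: field_simps power_int_minus power_inverse)
    obtain M where M: "\<forall>n\<ge>M. rat_pabs p (Z n - of_int (r j)) \<le> real p powi (- int j)"
      using r(3) by blast
    have "rat_pabs p (S N - X N) < e" if N: "N \<ge> max M (max K j)" for N
    proof -
      have "rat_pabs p (of_int (r (N + K) - r j)) \<le> real p powi (- int j)"
        unfolding rat_pabs_int_le_iff by (rule rr) (use N in simp)
      then have "rat_pabs p (of_int (r (N + K)) - Z N) \<le> real p powi (- int j)"
        using M N rat_pabs_diff_le[of "of_int (r (N + K) - r j)" "Z N - of_int (r j)"] by fastforce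
      moreover have "of_int (r (N + K)) - Z N = of_nat p ^ K * (S N - X N)"
        using S[of N] N by (simp add: Z_def algebra_simps)
      ultimately have "inverse (real p ^ K) * rat_pabs p (S N - X N) \<le> real p powi (- int j)"
        by (simp only: rat_pabs_mult pK)
      then have "rat_pabs p (S N - X N) \<le> real p ^ K * real p powi (- int j)"
        using p_gt1 by (simp add: field_simps)
      then show ?thesis using j by simp
    qed
    then show "\<exists>M. \<forall>N\<ge>M. rat_pabs p (S N - X N) < e" by blast
  qed
  moreover have "D n < p" for n using d2 p by (auto simp: D_def prime_gt_0_nat)
  moreover have "\<forall>n<(- int K). D n = 0" by (simp add: D_def)
  ultimately have "is_expansion p x D"
    unfolding is_expansion_def X(2) mem_coset_iff S_def by blast
  then show ?thesis by blast
qed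

lemma expansion_unique:
  assumes "x \<in> carrier (Qp p)" "is_expansion p x d" "is_expansion p x e" shows "d = e"
proof (rule ccontr)
  assume "d \<noteq> e"
  then obtain k0 where k0: "d k0 \<noteq> e k0" by blast
  obtain X where X: "x = pnull p +>\<^bsub>pCauchy_ring p\<^esub> X"
    using assms(1) unfolding carrier_Qp by auto
  obtain L where L: "\<And>n. n < L \<Longrightarrow> d n = e n"
    using assms(2,3) unfolding is_expansion_def by (metis less_trans linorder_neqE)
  obtain k where k: "d k \<noteq> e k" "\<And>n. n < k \<Longrightarrow> d n = e n"
  proof -
    define i where "i = (LEAST i. d (L + int i) \<noteq> e (L + int i))"
    have ex: "d (L + int (nat (k0 - L))) \<noteq> e (L + int (nat (k0 - L)))" using k0 L[of k0] by force
    have "d (L + int i) \<noteq> e (L + int i)" unfolding i_def using ex by (rule LeastI)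
    moreover have "d n = e n" if "n < L + int i" for n
    proof (cases "n < L")
      case False
      then have "nat (n - L) < i" using that by simp
      from not_less_Least[OF this[unfolded i_def]] False show ?thesis by simp
    qed (rule L)
    ultimately show ?thesis using that by blast
  qed
  define t where "t = (\<lambda>n. of_int (int (d n) - int (e n)) * of_nat p powi n :: rat)"
  have dp: "d n < p" "e n < p" for n using assms(2,3) unfolding is_expansion_def by auto
  have "\<not> int p dvd int (d k) - int (e k)"
    using k(1) dp[of k] dvd_imp_le_int[of "int (d k) - int (e k)" "int p"] by auto
  then have "rat_pabs p (of_int (int (d k) - int (e k))) > real p powi (- int 1)"
    using rat_pabs_int_le_iff[of _ 1] by (metis not_le power_one_right)
  then have tk: "rat_pabs p (t k) > real p powi (- k - 1)"
    unfolding t_def rat_pabs_mult rat_pabs_power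
    using p_gt1 by (simp add: power_int_diff power_int_minus field_simps del: of_int_diff)
  have tn: "rat_pabs p (t n) \<le> real p powi (- k - 1)" if "n > k" for n
  proof -
    have "rat_pabs p (of_int (int (d n) - int (e n))) \<le> 1"
      using rat_pabs_int_le_iff[of "int (d n) - int (e n)" 0] by simp
    then have "rat_pabs p (t n) \<le> 1 * real p powi (- n)"
      unfolding t_def rat_pabs_mult rat_pabs_power by (intro mult_right_mono) auto
    also have "\<dots> \<le> real p powi (- k - 1)" using that by (simp add: p_powi_le_iff)
    finally show ?thesis .
  qed
  have "(\<lambda>N. (\<Sum>n\<in>{- int N..<int N}. of_nat (d n) * of_nat p powi n) -
             (\<Sum>n\<in>{- int N..<int N}. of_nat (e n) * of_nat p powi n)) \<in> pnull p"
    using assms(2,3) pnull_add[OF _ pnull_uminus] unfolding is_expansion_def X mem_coset_iff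
    by fastforce
  then have "(\<lambda>N. \<Sum>n\<in>{- int N..<int N}. t n) \<in> pnull p"
    by (simp add: t_def left_diff_distrib sum_subtractf)
  moreover have "real p powi (- k - 1) > 0" using p_gt1 by simp
  ultimately obtain M where M: "\<forall>N\<ge>M. rat_pabs p (\<Sum>n\<in>{- int N..<int N}. t n) < real p powi (- k - 1)"
    unfolding pnull_iff by blast
  define N where "N = max M (nat \<bar>k\<bar> + 1)"
  have kN: "k \<in> {- int N..<int N}" unfolding N_def by auto
  have "rat_pabs p (\<Sum>n\<in>{- int N..<int N} - {k}. t n) \<le> real p powi (- k - 1)"
  proof (rule rat_pabs_sum_le)
    fix n assume "n \<in> {- int N..<int N} - {k}"
    then show "rat_pabs p (t n) \<le> real p powi (- k - 1)"
      using k(2)[of n] tn[of n] p_gt1 by (cases "n < k") (auto simp: t_def)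
  qed (use p_gt1 in simp)
  moreover have "rat_pabs p (\<Sum>n\<in>{- int N..<int N}. t n) \<le> real p powi (- k - 1)"
    using M by (simp add: N_def less_imp_le)
  moreover have "t k = (\<Sum>n\<in>{- int N..<int N}. t n) - (\<Sum>n\<in>{- int N..<int N} - {k}. t n)"
    using kN by (simp add: sum.remove)
  ultimately show False
    using tk rat_pabs_diff_le[of "\<Sum>n\<in>{- int N..<int N}. t n" "\<Sum>n\<in>{- int N..<int N} - {k}. t n"] by simp
qed

theorem ex1_expansion: "x \<in> carrier (Qp p) \<Longrightarrow> \<exists>!d. is_expansion p x d"
  using expansion_exists expansion_unique by blast

lemma is_expansion_digit: "x \<in> carrier (Qp p) \<Longrightarrow> is_expansion p x (digit p x)"
  unfolding digit_def by (rule theI'[OF ex1_expansion])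

end

end

theory Submission
  imports Defs
begin

text \<open>
  If \<open>\<bar>x - y\<bar> = 1\<close>, the expansions of \<open>x\<close> and \<open>y\<close> agree at all negative positions and differ at
  position \<open>0\<close> (\<open>digits_of_unit_distance\<close>). Since \<open>\<chi>\<^sub>n\<close> only sees digits at positions up to \<open>n\<close>,
  all terms of \<open>\<Upsilon>(x) - \<Upsilon>(y)\<close> with \<open>n < 0\<close> cancel, and
  \<open>\<Upsilon>(x) - \<Upsilon>(y) = (\<Sum>n\<ge>0. s\<^sup>n * (\<chi>\<^sub>n(x) - \<chi>\<^sub>n(y)))\<close> (\<open>Upsilon_diff\<close>).

  In the term for \<open>n = 0\<close> the two angles differ by \<open>2\<pi>d/p\<close>, where \<open>d = x\<^sub>0 - y\<^sub>0\<close> satisfies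
  \<open>1 \<le> \<bar>d\<bar> \<le> p - 1\<close>, because the lower digits contribute equally to both. This chord of the unit
  circle has length \<open>2\<bar>sin(\<pi>d/p)\<bar> \<ge> 2 sin(\<pi>/p)\<close>. Every other difference of characters has modulus
  at most \<open>2\<close>, so the terms with \<open>n \<ge> 1\<close> add up to at most \<open>2\<bar>s\<bar>/(1 - \<bar>s\<bar>)\<close>. The reverse triangle
  inequality gives the bound for each such pair (\<open>norm_Upsilon_diff_ge\<close>), hence for the infimum. Positivity for
  small \<open>\<bar>s\<bar>\<close> holds because \<open>t/(1 - t) < \<sigma>\<close> is the same as \<open>t < \<sigma>/(1 + \<sigma>)\<close>.
\<close>

section \<open>Digits of a difference of absolute value one\<close>

lemma first_difference:
  fixes d e :: "int \<Rightarrow> nat"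
  assumes "\<And>n. n < L \<Longrightarrow> d n = e n" and "d k0 \<noteq> e k0"
  obtains k where "k \<le> k0" "d k \<noteq> e k" "\<And>n. n < k \<Longrightarrow> d n = e n"
proof -
  let ?P = "\<lambda>i. d (L + int i) \<noteq> e (L + int i)"
  have L: "L \<le> k0" using assms by force
  then have ex: "?P (nat (k0 - L))" using assms(2) by simp
  define i where "i = (LEAST i. ?P i)"
  have i: "?P i" "i \<le> nat (k0 - L)"
    unfolding i_def using ex by (rule LeastI, rule Least_le)
  have "d n = e n" if "n < L + int i" for n
  proof (cases "n < L")
    case False
    then have "nat (n - L) < i" using that by simp
    from not_less_Least[OF this[unfolded i_def]] False show ?thesis by simp
  qed (rule assms(1))
  then show ?thesis using that[of "L + int i"] i L by auto
qed

context
  fixes p :: nat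
  assumes p: "prime p"
begin

text \<open>
  In \<open>\<Sum>n\<ge>k. t\<^sub>n p\<^sup>n = 0\<close> every term after the first is divisible by \<open>p\<^bsup>k+1\<^esup>\<close>, hence so is the first.
  Arbitrary integer coefficients are allowed because the lemma is applied to termwise differences of
  digit sequences, which avoids any carrying.
\<close>

lemma null_series_leading_coeff_dvd:
  fixes t :: "int \<Rightarrow> int"
  assumes null: "(\<lambda>N. \<Sum>n\<in>{- int N..<int N}. of_int (t n) * of_nat p powi n) \<in> pnull p"
    and zero: "\<And>n. n < k \<Longrightarrow> t n = 0"
  shows "int p dvd t k"
proof -
  note pgt1 = p_gt1[OF p]
  define u where "u = (\<lambda>n. of_int (t n) * of_nat p powi n :: rat)"
  have pos: "real p powi (- k - 1) > 0" using pgt1 by simp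
  obtain M where M: "\<forall>N\<ge>M. rat_pabs p (\<Sum>n\<in>{- int N..<int N}. u n) < real p powi (- k - 1)"
    using null pos unfolding pnull_iff[OF p] u_def by blast
  define N where "N = max M (nat \<bar>k\<bar> + 1)"
  have kN: "k \<in> {- int N..<int N}" unfolding N_def by auto
  have "rat_pabs p (u n) \<le> real p powi (- k - 1)" if "n \<noteq> k" for n
  proof (cases "n < k")
    case True
    then show ?thesis using pos zero p by (simp add: u_def rat_pabs_zero)
  next
    case False
    have "rat_pabs p (of_int (t n)) \<le> 1"
      using rat_pabs_int_le_iff[OF p, of "t n" 0] by simp
    then have "rat_pabs p (u n) \<le> 1 * real p powi (- n)"
      unfolding u_def rat_pabs_mult[OF p] rat_pabs_power[OF p] by (intro mult_right_mono) auto
    also have "\<dots> \<le> real p powi (- k - 1)"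
      using that False by (simp add: p_powi_le_iff[OF p])
    finally show ?thesis .
  qed
  then have "rat_pabs p (\<Sum>n\<in>{- int N..<int N} - {k}. u n) \<le> real p powi (- k - 1)"
    using pos by (intro rat_pabs_sum_le[OF p]) auto
  moreover have "rat_pabs p (\<Sum>n\<in>{- int N..<int N}. u n) \<le> real p powi (- k - 1)"
    using M by (simp add: N_def less_imp_le)
  moreover have "u k = (\<Sum>n\<in>{- int N..<int N}. u n) - (\<Sum>n\<in>{- int N..<int N} - {k}. u n)"
    using kN by (simp add: sum.remove)
  ultimately have "rat_pabs p (u k) \<le> real p powi (- k - 1)"
    using rat_pabs_diff_le[OF p, of "\<Sum>n\<in>{- int N..<int N}. u n"
      "\<Sum>n\<in>{- int N..<int N} - {k}. u n"] by simp
  then have "rat_pabs p (of_int (t k)) * real p powi (- k) \<le> real p powi (- 1) * real p powi (- k)"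
    using pgt1 unfolding u_def rat_pabs_mult[OF p] rat_pabs_power[OF p]
    by (simp add: power_int_diff mult.commute divide_inverse)
  then have "rat_pabs p (of_int (t k)) \<le> real p powi (- int 1)"
    using pgt1 by simp
  then show ?thesis using rat_pabs_int_le_iff[OF p, of "t k" 1] by simp
qed

lemma Qp_mem_diff:
  assumes "x \<in> carrier (Qp p)" "X \<in> x" "Y \<in> x"
  shows "(\<lambda>n. X n - Y n) \<in> pnull p"
proof -
  obtain W where "x = pnull p +>\<^bsub>pCauchy_ring p\<^esub> W"
    using assms(1) unfolding carrier_Qp[OF p] by auto
  then show ?thesis
    using assms(2,3) pnull_add[OF p _ pnull_uminus[OF p], of "\<lambda>n. X n - W n" "\<lambda>n. Y n - W n"]
    by (simp add: mem_coset_iff[OF p])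
qed

lemma Qp_add_mem: "X \<in> x \<Longrightarrow> Y \<in> y \<Longrightarrow> (\<lambda>n. X n + Y n) \<in> x \<oplus>\<^bsub>Qp p\<^esub> y"
  unfolding Qp_def FactRing_def set_add_def set_mult_def by (auto simp: pCauchy_ring_def)

lemma Qp_zero: "\<zero>\<^bsub>Qp p\<^esub> = pnull p"
  using Qp_simps(3)[OF p pCauchy_const[OF p] pCauchy_const[OF p]] .

lemma digit_eqI: "x \<in> carrier (Qp p) \<Longrightarrow> is_expansion p x d \<Longrightarrow> digit p x = d"
  using expansion_unique[OF p] is_expansion_digit[OF p] by blast

lemma digit_zero: "digit p \<zero>\<^bsub>Qp p\<^esub> = (\<lambda>_. 0)"
proof (rule digit_eqI)
  interpret cring "Qp p" by (rule cring_Qp[OF p])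
  show "\<zero>\<^bsub>Qp p\<^esub> \<in> carrier (Qp p)" by simp
  show "is_expansion p \<zero>\<^bsub>Qp p\<^esub> (\<lambda>_. 0)"
    using p by (auto simp: is_expansion_def Qp_zero pnull_def prime_gt_0_nat rat_pabs_zero)
qed

lemma digit_one: "digit p \<one>\<^bsub>Qp p\<^esub> = (\<lambda>n. if n = 0 then 1 else 0)"
proof (rule digit_eqI)
  interpret cring "Qp p" by (rule cring_Qp[OF p])
  show "\<one>\<^bsub>Qp p\<^esub> \<in> carrier (Qp p)" by simp
  let ?d = "\<lambda>n::int. if n = 0 then 1 else 0 :: nat"
  let ?S = "\<lambda>N. \<Sum>n\<in>{- int N..<int N}. of_nat (?d n) * of_nat p powi n :: rat"
  have S: "?S N = 1" if "N \<ge> 1" for N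
  proof -
    have "?S N = (\<Sum>n\<in>{0}. of_nat (?d n) * of_nat p powi n)"
      by (rule sum.mono_neutral_right) (use that in auto)
    then show ?thesis by simp
  qed
  have "(\<lambda>N. ?S N - 1) \<in> pnull p"
    unfolding pnull_iff[OF p] using S by (metis diff_self rat_pabs_zero[OF p])
  then have "?S \<in> \<one>\<^bsub>Qp p\<^esub>"
    by (simp add: Qp_simps(2)[OF p pCauchy_const[OF p] pCauchy_const[OF p]] mem_coset_iff[OF p])
  then show "is_expansion p \<one>\<^bsub>Qp p\<^esub> ?d"
    using prime_gt_1_nat[OF p] by (auto simp: is_expansion_def)
qed

lemma digit_less: "x \<in> carrier (Qp p) \<Longrightarrow> digit p x n < p"
  using is_expansion_digit[OF p] by (auto simp: is_expansion_def)

lemma digits_bounded_below: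
  assumes "x \<in> carrier (Qp p)"
  obtains L where "\<And>n. n < L \<Longrightarrow> digit p x n = 0"
  using is_expansion_digit[OF p assms] unfolding is_expansion_def by blast

lemma val_eqI: "digit p x n \<noteq> 0 \<Longrightarrow> (\<And>k. k < n \<Longrightarrow> digit p x k = 0) \<Longrightarrow> val p x = n"
  unfolding val_def by (rule the_equality) (blast, metis linorder_neqE)

lemma digit_val:
  assumes x: "x \<in> carrier (Qp p)" and nz: "x \<noteq> \<zero>\<^bsub>Qp p\<^esub>"
  shows "digit p x (val p x) \<noteq> 0" and "k < val p x \<Longrightarrow> digit p x k = 0"
proof -
  interpret cring "Qp p" by (rule cring_Qp[OF p])
  obtain L where L: "\<And>n. n < L \<Longrightarrow> digit p x n = 0" using digits_bounded_below[OF x] by blast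
  have "\<exists>k0. digit p x k0 \<noteq> 0"
  proof (rule ccontr)
    assume "\<nexists>k0. digit p x k0 \<noteq> 0"
    then have "(\<lambda>_. 0) \<in> x" using is_expansion_digit[OF p x] by (simp add: is_expansion_def)
    moreover obtain X where X: "x = pnull p +>\<^bsub>pCauchy_ring p\<^esub> X"
      using x unfolding carrier_Qp[OF p] by auto
    ultimately have "(\<lambda>n. X n - 0) \<in> pnull p"
      using pnull_uminus[OF p, of "\<lambda>n. 0 - X n"] by (simp add: mem_coset_iff[OF p])
    then have "x = pnull p +>\<^bsub>pCauchy_ring p\<^esub> (\<lambda>_. 0)"
      unfolding X by (rule coset_eqI[OF p])
    then show False using nz by (auto simp: Qp_zero mem_coset_iff[OF p])
  qed
  then obtain k0 where "digit p x k0 \<noteq> 0" by blast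
  then obtain k where k: "digit p x k \<noteq> 0" "\<And>n. n < k \<Longrightarrow> digit p x n = 0"
    using first_difference[of L "digit p x" "\<lambda>_. 0" k0] L by metis
  then have "val p x = k" by (rule val_eqI)
  with k show "digit p x (val p x) \<noteq> 0" "k < val p x \<Longrightarrow> digit p x k = 0" for k by auto
qed

lemma pabs_eq_1_iff:
  assumes "x \<in> carrier (Qp p)"
  shows "pabs p x = 1 \<longleftrightarrow> digit p x 0 \<noteq> 0 \<and> (\<forall>k<0. digit p x k = 0)"
proof
  assume *: "pabs p x = 1"
  then have nz: "x \<noteq> \<zero>\<^bsub>Qp p\<^esub>" by (auto simp: pabs_def)
  then have "real p powi (- val p x) = real p powi 0" using * by (simp add: pabs_def)
  then have "val p x = 0"
    using p_powi_le_iff[OF p] by (metis antisym neg_0_le_iff_le neg_le_0_iff_le order_refl)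
  then show "digit p x 0 \<noteq> 0 \<and> (\<forall>k<0. digit p x k = 0)"
    using digit_val[OF assms nz] by auto
next
  assume *: "digit p x 0 \<noteq> 0 \<and> (\<forall>k<0. digit p x k = 0)"
  then have "x \<noteq> \<zero>\<^bsub>Qp p\<^esub>" using digit_zero by auto
  moreover have "val p x = 0" using * by (intro val_eqI) auto
  ultimately show "pabs p x = 1" by (simp add: pabs_def)
qed

text \<open>
  With \<open>z = x - y\<close>, the leading coefficient of \<open>\<Sum>n. (x\<^sub>n - z\<^sub>n - y\<^sub>n) p\<^sup>n = 0\<close> is divisible by \<open>p\<close>. A first
  disagreement of \<open>x\<close> and \<open>y\<close> at a negative position would be such a coefficient, since \<open>z\<close> has no digits
  there; agreement at \<open>0\<close> as well would make \<open>p\<close> divide \<open>z\<^sub>0\<close>.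
\<close>

lemma digits_of_unit_distance:
  assumes x: "x \<in> carrier (Qp p)" and y: "y \<in> carrier (Qp p)"
    and xy: "pabs p (x \<ominus>\<^bsub>Qp p\<^esub> y) = 1"
  shows "digit p x 0 \<noteq> digit p y 0" and "\<And>n. n < 0 \<Longrightarrow> digit p x n = digit p y n"
proof -
  interpret cring "Qp p" by (rule cring_Qp[OF p])
  define z where "z = x \<ominus>\<^bsub>Qp p\<^esub> y"
  have z: "z \<in> carrier (Qp p)" using x y by (simp add: z_def)
  have x_eq: "x = z \<oplus>\<^bsub>Qp p\<^esub> y" using x y by (simp add: z_def minus_eq a_assoc l_neg)
  have z0: "digit p z 0 \<noteq> 0" "\<And>n. n < 0 \<Longrightarrow> digit p z n = 0"
    using xy pabs_eq_1_iff[OF z] by (auto simp: z_def)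
  define S where "S = (\<lambda>w N. \<Sum>n\<in>{- int N..<int N}. of_nat (digit p w n) * of_nat p powi n :: rat)"
  have S: "S w \<in> w" if "w \<in> carrier (Qp p)" for w
    using is_expansion_digit[OF p that] by (simp add: is_expansion_def S_def)
  define t where "t = (\<lambda>n. int (digit p x n) - (int (digit p z n) + int (digit p y n)))"
  have "(\<lambda>N. S x N - (S z N + S y N)) \<in> pnull p"
    using Qp_mem_diff[OF x S[OF x]] Qp_add_mem[OF S[OF z] S[OF y]] x_eq by simp
  then have null: "(\<lambda>N. \<Sum>n\<in>{- int N..<int N}. of_int (t n) * of_nat p powi n) \<in> pnull p"
    by (simp add: S_def t_def algebra_simps sum.distrib sum_subtractf)
  show below: "digit p x n = digit p y n" if "n < 0" for n
  proof (rule ccontr)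
    assume ne: "digit p x n \<noteq> digit p y n"
    obtain L L' where "\<And>n. n < L \<Longrightarrow> digit p x n = 0" "\<And>n. n < L' \<Longrightarrow> digit p y n = 0"
      using digits_bounded_below[OF x] digits_bounded_below[OF y] by metis
    then obtain k where k: "k \<le> n" "digit p x k \<noteq> digit p y k"
        "\<And>j. j < k \<Longrightarrow> digit p x j = digit p y j"
      using first_difference[of "min L L'" "digit p x" "digit p y" n] ne by (metis min_less_iff_conj)
    have "int p dvd t k"
      by (rule null_series_leading_coeff_dvd[OF null]) (use k that z0 in \<open>simp add: t_def\<close>)
    then have "int p dvd int (digit p x k) - int (digit p y k)"
      using k(1) that z0(2) by (simp add: t_def)
    then show False
      using k(2) digit_less[OF x, of k] digit_less[OF y, of k]
        dvd_imp_le_int[of "int (digit p x k) - int (digit p y k)" "int p"] by auto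
  qed
  show "digit p x 0 \<noteq> digit p y 0"
  proof
    assume eq: "digit p x 0 = digit p y 0"
    have "int p dvd t 0"
      by (rule null_series_leading_coeff_dvd[OF null]) (use below z0 in \<open>simp add: t_def\<close>)
    then have "p dvd digit p z 0" using eq by (simp add: t_def)
    then show False using z0(1) digit_less[OF z, of 0] by (auto dest: dvd_imp_le)
  qed
qed


section \<open>The maps \<open>\<Upsilon>\<close> as power series\<close>

definition chi_angle :: "enat \<Rightarrow> int \<Rightarrow> (nat \<Rightarrow> rat) set \<Rightarrow> real" where
  "chi_angle m n x = (case m of
      enat M \<Rightarrow> (\<Sum>k\<le>M. real (digit p x (n - int k)) / real p ^ k)
    | \<infinity> \<Rightarrow> (\<Sum>k. real (digit p x (n - int k)) / real p ^ k))"

lemma chi_eq_cis: "chi p m n x = cis (2 * pi / real p * chi_angle m n x)"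
  unfolding chi_def chi_angle_def[symmetric] cis_conv_exp by (simp add: mult_ac)

lemma norm_chi: "cmod (chi p m n x) = 1"
  by (simp add: chi_eq_cis)

lemma chi_cong: "(\<And>k. k \<le> n \<Longrightarrow> digit p x k = digit p y k) \<Longrightarrow> chi p m n x = chi p m n y"
  by (cases m) (simp_all add: chi_def)

lemma chi_eq_1: "(\<And>k. k \<le> n \<Longrightarrow> digit p x k = 0) \<Longrightarrow> chi p m n x = 1"
  by (cases m) (simp_all add: chi_def)

text \<open>
  For \<open>m = \<infinity>\<close> the angle may be split termwise because only finitely many digits lie below \<open>n\<close>.
\<close>

lemma chi_angle_diff:
  assumes x: "x \<in> carrier (Qp p)" and y: "y \<in> carrier (Qp p)"
    and eq: "\<And>k. k < n \<Longrightarrow> digit p x k = digit p y k"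
  shows "chi_angle m n x - chi_angle m n y = real (digit p x n) - real (digit p y n)"
proof -
  let ?f = "\<lambda>w k. real (digit p w (n - int k)) / real p ^ k"
  have f: "?f x k - ?f y k = (if k = 0 then real (digit p x n) - real (digit p y n) else 0)" for k
    using eq[of "n - int k"] by simp
  show ?thesis
  proof (cases m)
    case (enat M)
    then show ?thesis by (simp add: chi_angle_def sum_subtractf[symmetric] f)
  next
    case infinity
    have summable: "summable (?f w)" if w: "w \<in> carrier (Qp p)" for w
    proof -
      obtain L where L: "\<And>k. k < L \<Longrightarrow> digit p w k = 0" using digits_bounded_below[OF w] by blast
      show ?thesis by (rule summable_finite[of "{..nat (n - L)}"]) (auto intro!: L)
    qed
    have "chi_angle m n x - chi_angle m n y = (\<Sum>k. ?f x k - ?f y k)"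
      using infinity by (simp add: chi_angle_def suminf_diff summable x y)
    then show ?thesis
      using sums_single[of 0 "\<lambda>k. real (digit p x n) - real (digit p y n)"]
      by (simp add: f sums_iff)
  qed
qed

lemma summable_chi:
  assumes "s \<noteq> 0" and "cmod s < 1"
  shows "summable (\<lambda>j. s powi (N + int j) * chi p m (M + int j) x)"
proof (rule summable_norm_cancel)
  have "summable (\<lambda>j. cmod s powi N * cmod s ^ j)"
    using assms by (intro summable_mult summable_geometric) simp
  then show "summable (\<lambda>j. cmod (s powi (N + int j) * chi p m (M + int j) x))"
    using assms by (simp add: norm_mult norm_chi norm_power_int norm_power power_int_add)
qed

lemma powi_geometric_sums:
  fixes s :: complex
  assumes "s \<noteq> 0" and "cmod s < 1"
  shows "(\<lambda>j. s powi (N + int j)) sums (s powi N / (1 - s))"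
  using sums_mult[OF geometric_sums[OF assms(2)], of "s powi N"] assms(1)
  by (simp add: power_int_add)

text \<open>
  Subtracting \<open>1\<close> from each character absorbs the geometric correction \<open>(1 - s\<^sup>v) / (1 - s)\<close>. The series may
  then start at any position below the valuation, and \<open>x = 0\<close> is no longer exceptional, so two points
  of different valuation can be compared term by term.
\<close>

lemma Upsilon_eq:
  assumes x: "x \<in> carrier (Qp p)" and s: "s \<noteq> 0" "cmod s < 1"
    and N: "\<And>k. k < N \<Longrightarrow> digit p x k = 0"
  shows "Upsilon p m s x = 1 / (1 - s) + (\<Sum>j. s powi (N + int j) * (chi p m (N + int j) x - 1))"
proof (cases "x = \<zero>\<^bsub>Qp p\<^esub>")
  case True
  then show ?thesis by (simp add: Upsilon_def chi_eq_1 digit_zero)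
next
  case False
  define v where "v = val p x"
  have v: "digit p x v \<noteq> 0" "\<And>k. k < v \<Longrightarrow> digit p x k = 0"
    using digit_val[OF x False] by (auto simp: v_def)
  then have "N \<le> v" using N[of v] by (metis not_less)
  let ?g = "\<lambda>N j. s powi (N + int j) * (chi p m (N + int j) x - 1)"
  have g: "?g N = (\<lambda>j. s powi (N + int j) * chi p m (N + int j) x - s powi (N + int j))" for N
    by (simp add: algebra_simps)
  have sg: "summable (?g N)" for N
    unfolding g by (intro summable_diff summable_chi s) (rule sums_summable[OF powi_geometric_sums[OF s]])
  have "Upsilon p m s x = (1 - s powi v) / (1 - s) + (\<Sum>j. ?g v j) + s powi v / (1 - s)"
    using False powi_geometric_sums[OF s, of v]
    by (simp add: Upsilon_def g suminf_diff[symmetric] summable_chi[OF s] sums_iff flip: v_def)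
  also have "\<dots> = 1 / (1 - s) + (\<Sum>j. ?g v j)"
    by (simp add: diff_divide_distrib)
  also have "(\<Sum>j. ?g v j) = (\<Sum>j. ?g N (j + nat (v - N)))"
    using \<open>N \<le> v\<close> by (simp add: add_ac)
  also have "\<dots> = (\<Sum>j. ?g N j) - (\<Sum>j<nat (v - N). ?g N j)"
    by (rule suminf_minus_initial_segment[OF sg])
  also have "(\<Sum>j<nat (v - N). ?g N j) = 0"
    by (intro sum.neutral ballI) (auto intro!: chi_eq_1 v)
  finally show ?thesis by simp
qed

lemma Upsilon_diff:
  assumes x: "x \<in> carrier (Qp p)" and y: "y \<in> carrier (Qp p)" and s: "s \<noteq> 0" "cmod s < 1"
    and eq: "\<And>n. n < 0 \<Longrightarrow> digit p x n = digit p y n"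
  shows "Upsilon p m s x - Upsilon p m s y = (\<Sum>j. s ^ j * (chi p m (int j) x - chi p m (int j) y))"
proof -
  obtain L L' where "\<And>n. n < L \<Longrightarrow> digit p x n = 0" "\<And>n. n < L' \<Longrightarrow> digit p y n = 0"
    using digits_bounded_below[OF x] digits_bounded_below[OF y] by metis
  moreover define K where "K = nat (max (- L) (- L'))"
  moreover have "n < L" "n < L'" if "n < - int K" for n
    using that by (auto simp: K_def max_def split: if_splits)
  ultimately have K: "\<And>n. n < - int K \<Longrightarrow> digit p x n = 0" "\<And>n. n < - int K \<Longrightarrow> digit p y n = 0"
    by blast+
  let ?h = "\<lambda>w j. s powi (- int K + int j) * chi p m (- int K + int j) w"
  let ?g = "\<lambda>j. ?h x j - ?h y j"
  have sh: "summable (?h w)" for w by (rule summable_chi[OF s])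
  have g1: "summable (\<lambda>j. s powi (- int K + int j) * (chi p m (- int K + int j) w - 1))" for w
    unfolding right_diff_distrib mult_1_right
    by (intro summable_diff sh) (rule sums_summable[OF powi_geometric_sums[OF s]])
  have "Upsilon p m s x - Upsilon p m s y = (\<Sum>j. ?g j)"
    using Upsilon_eq[OF x s K(1), where m = m] Upsilon_eq[OF y s K(2), where m = m] suminf_diff[OF g1 g1, of x y]
    by (simp add: algebra_simps)
  also have "\<dots> = (\<Sum>j. ?g (j + K)) + (\<Sum>j<K. ?g j)"
    by (intro suminf_split_initial_segment summable_diff sh)
  also have "(\<Sum>j<K. ?g j) = 0"
    by (intro sum.neutral ballI) (auto intro!: chi_cong eq)
  finally show ?thesis by (simp add: algebra_simps)
qed


section \<open>Lower bound for the separation constant\<close>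

lemma norm_cis_diff: "cmod (cis a - cis b) = 2 * \<bar>sin ((a - b) / 2)\<bar>"
proof -
  have "cos (a - b) = 1 - 2 * (sin ((a - b) / 2))\<^sup>2"
    using cos_double_sin[of "(a - b) / 2"] by (simp only: mult_2 field_sum_of_halves)
  moreover have "(cmod (cis a - cis b))\<^sup>2 = 2 - 2 * cos (a - b)"
  proof -
    have "(cmod (cis a - cis b))\<^sup>2
        = ((sin a)\<^sup>2 + (cos a)\<^sup>2) + ((sin b)\<^sup>2 + (cos b)\<^sup>2) - 2 * (cos a * cos b + sin a * sin b)"
      unfolding cmod_power2 by (simp add: power2_eq_square algebra_simps)
    then show ?thesis by (simp add: cos_diff)
  qed
  ultimately have "(cmod (cis a - cis b))\<^sup>2 = (2 * \<bar>sin ((a - b) / 2)\<bar>)\<^sup>2"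
    by (simp add: power_mult_distrib)
  then show ?thesis by (rule power2_eq_imp_eq) auto
qed

text \<open>
  The sine increases on \<open>[0, \<pi>/2]\<close> and is symmetric about \<open>\<pi>/2\<close>, so on \<open>[\<pi>/p, \<pi> - \<pi>/p]\<close> it is smallest at
  the ends.
\<close>

lemma sin_pi_frac_le:
  fixes d :: real
  assumes "1 \<le> \<bar>d\<bar>" "\<bar>d\<bar> \<le> real p - 1"
  shows "sin (pi / real p) \<le> \<bar>sin (pi * d / real p)\<bar>"
proof -
  have pp: "real p \<ge> 2" using prime_ge_2_nat[OF p] by simp
  let ?e = "\<bar>d\<bar>"
  have base: "sin (pi / real p) \<le> sin (pi * e / real p)" if "1 \<le> e" "e \<le> real p / 2" for e
  proof (rule sin_monotone_2pi_le)
    show "- (pi / 2) \<le> pi / real p" by (rule order_trans[of _ 0]) auto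
    show "pi / real p \<le> pi * e / real p" using that pp by (simp add: divide_right_mono)
    show "pi * e / real p \<le> pi / 2" using that pp by (simp add: field_simps)
  qed
  have "sin (pi / real p) \<le> sin (pi * ?e / real p)"
  proof (cases "?e \<le> real p / 2")
    case True
    then show ?thesis using base assms by simp
  next
    case False
    have "sin (pi * (real p - ?e) / real p) = sin (pi - pi * ?e / real p)"
      using pp by (simp add: right_diff_distrib diff_divide_distrib)
    then show ?thesis using base[of "real p - ?e"] False assms by simp
  qed
  also have "\<dots> \<le> \<bar>sin (pi * d / real p)\<bar>" by (cases "d \<ge> 0") auto
  finally show ?thesis .
qed

lemma norm_Upsilon_diff_ge:
  assumes x: "x \<in> carrier (Qp p)" and y: "y \<in> carrier (Qp p)" and s: "s \<noteq> 0" "cmod s < 1"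
    and xy: "pabs p (x \<ominus>\<^bsub>Qp p\<^esub> y) = 1"
  shows "cmod (Upsilon p m s x - Upsilon p m s y) \<ge> 2 * (sin (pi / real p) - cmod s / (1 - cmod s))"
proof -
  note dg = digits_of_unit_distance[OF x y xy]
  define D where "D = (\<lambda>j. chi p m (int j) x - chi p m (int j) y)"
  have D2: "cmod (D j) \<le> 2" for j
    using norm_triangle_ineq4[of "chi p m (int j) x" "chi p m (int j) y"] by (simp add: D_def norm_chi)
  let ?d = "real (digit p x 0) - real (digit p y 0)"
  have "(2 * pi / real p * chi_angle m 0 x - 2 * pi / real p * chi_angle m 0 y) / 2
      = pi * (chi_angle m 0 x - chi_angle m 0 y) / real p"
    by (simp add: algebra_simps diff_divide_distrib)
  also have "\<dots> = pi * ?d / real p"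
    using chi_angle_diff[OF x y dg(2), where m = m and n = 0] by simp
  finally have "cmod (D 0) = 2 * \<bar>sin (pi * ?d / real p)\<bar>"
    by (simp only: D_def chi_eq_cis norm_cis_diff int_ops)
  moreover have "sin (pi / real p) \<le> \<bar>sin (pi * ?d / real p)\<bar>"
    using dg(1) digit_less[OF x, of 0] digit_less[OF y, of 0] by (intro sin_pi_frac_le) auto
  ultimately have D0: "cmod (D 0) \<ge> 2 * sin (pi / real p)" by simp
  have "(\<lambda>j. 2 * cmod s * cmod s ^ j) sums (2 * cmod s * (1 / (1 - cmod s)))"
    using s by (intro sums_mult geometric_sums) simp
  then have geo: "(\<lambda>j. 2 * cmod s * cmod s ^ j) sums (2 * (cmod s / (1 - cmod s)))" by simp
  have bound: "cmod (s ^ Suc j * D (Suc j)) \<le> 2 * cmod s * cmod s ^ j" for j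
    using mult_left_mono[OF D2, of "cmod s ^ Suc j" "Suc j"]
    by (simp add: norm_mult norm_power mult_ac)
  have "summable (\<lambda>j. s ^ Suc j * D (Suc j))"
    using summable_comparison_test'[OF sums_summable[OF geo] bound] .
  then have "Upsilon p m s x - Upsilon p m s y = D 0 + (\<Sum>j. s ^ Suc j * D (Suc j))"
    using suminf_split_head[of "\<lambda>j. s ^ j * D j"] summable_Suc_iff[of "\<lambda>j. s ^ j * D j"]
    by (simp add: Upsilon_diff[OF x y s dg(2)] D_def)
  moreover have "cmod (\<Sum>j. s ^ Suc j * D (Suc j)) \<le> 2 * (cmod s / (1 - cmod s))"
    using norm_suminf_le[OF bound sums_summable[OF geo]] sums_unique[OF geo] by simp
  ultimately show ?thesis
    using D0 norm_diff_ineq[of "D 0" "\<Sum>j. s ^ Suc j * D (Suc j)"] by simp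
qed

lemma Delta_ge:
  assumes s: "s \<noteq> 0" "cmod s < 1"
  shows "Delta p m s \<ge> 2 * (sin (pi / real p) - cmod s / (1 - cmod s))"
  unfolding Delta_def
proof (rule cInf_greatest)
  \<comment> \<open>The infimum of the empty set of reals is unspecified, so a pair at distance one must be exhibited.\<close>
  interpret cring "Qp p" by (rule cring_Qp[OF p])
  have "pabs p (\<one>\<^bsub>Qp p\<^esub> \<ominus>\<^bsub>Qp p\<^esub> \<zero>\<^bsub>Qp p\<^esub>) = 1"
    by (simp add: minus_eq pabs_eq_1_iff digit_one)
  then show "{cmod (Upsilon p m s x - Upsilon p m s y) | x y.
      x \<in> carrier (Qp p) \<and> y \<in> carrier (Qp p) \<and> pabs p (x \<ominus>\<^bsub>Qp p\<^esub> y) = 1} \<noteq> {}"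
    using one_closed zero_closed by blast
qed (use norm_Upsilon_diff_ge s in blast)

end

theorem mainTheorem2:
  fixes p :: nat and m :: enat and s :: complex
  assumes "prime p" and "0 < cmod s" and "cmod s < 1"
  shows "Delta p m s / 2 \<ge> sin (pi / real p) - cmod s / (1 - cmod s) \<and>
    (cmod s < sin (pi / real p) / (1 + sin (pi / real p)) \<longrightarrow> Delta p m s > 0)"
proof -
  have ge: "Delta p m s / 2 \<ge> sin (pi / real p) - cmod s / (1 - cmod s)"
    using Delta_ge[OF assms(1), of s m] assms(2,3) by (simp add: mult.commute)
  have "Delta p m s > 0" if small: "cmod s < sin (pi / real p) / (1 + sin (pi / real p))"
  proof -
    have "sin (pi / real p) \<ge> 0"
      using prime_ge_2_nat[OF assms(1)] by (intro sin_ge_zero) (auto simp: field_simps)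
    then have "cmod s / (1 - cmod s) < sin (pi / real p)"
      using small assms(3) by (simp add: field_simps)
    then show ?thesis using ge by simp
  qed
  with ge show ?thesis by blast
qed

end
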